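(* Let $\varphi$ and $\varphi_\lambda$ ($\lambda>0$) be the probability function and its inner regularization defined in the context, where $\xi$ has a density with respect to Lebesgue measure and $\Phi$ is continuous. Then: a) For all $\lambda_1>\lambda_2>0$ and all $x\in\mathcal H$, $\varphi_{\lambda_1}(x)\ge \varphi_{\lambda_2}(x)$, and $\inf_{\lambda>0}\varphi_\lambda(x)=\varphi(x)$ for all $x\in\mathcal H$. b) For any sequences $\lambda_k\to 0$ ($\lambda_k>0$) and $x_k\to x$ in $\mathcal H$ (norm convergence), $$\limsup_{k\to\infty}\varphi_{\lambda_k}(x_k)\le \varphi(x).$$ Furthermore, if $h$ is sequentially weakly continuous on $\mathcal H$, then the same inequality holds for any sequences $\lambda_k\to0$ ($\lambda_k>0$) and $x_k\rightharpoonup x$ (weak convergence). c) For any sequence $\lambda_k\to 0$ ($\lambda_k>0$) and any sequence $x_k\to x\in\mathcal D$ (norm convergence), $\lim_{k\to\infty}\varphi_{\lambda_k}(x_k)=\varphi(x)$, where $\mathcal D$ is the open set $\mathcal D:=\{x\in\mathcal H:\ \exists z\in\mathbb R^m \text{ such that } S^h_\Phi(x,z)<h(x)\}$. d) The functions $\varphi$ and $\varphi_\lambda$ ($\lambda>0$) are sequentially weakly upper semicontinuous on $\mathcal H$. e) The functions $\varphi$ and $\varphi_\lambda$ ($\lambda>0$) are continuous on $\mathcal D$.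
   Context: $\mathcal H$ is a separable real Hilbert space; $\mathcal Y$ is a (possibly nonseparable) real Banach space with dual $\mathcal Y^*$; $\mathcal H\times\mathbb R^m$ carries the product inner product. $\mathcal K\subset\mathcal Y$ is a nonempty convex cone and $\mathcal K^+:=\{v^*\in\mathcal Y^*:\langle v^*,v\rangle\ge0\ \forall v\in\mathcal K\}$. $\mathcal C\subset\mathcal Y^*$ is a weak$^*$-compact convex set with $\operatorname{cl}^{w^*}\operatorname{cone}\mathcal C=\mathcal K^+$, where $\operatorname{cone}\mathcal C=\{tc:t\ge0,c\in\mathcal C\}$. $\Phi:\mathcal H\times\mathbb R^m\to\mathcal Y$ is continuous, and $h:\mathcal H\to\mathbb R$ is a continuously differentiable convex function such that for every $v^*\in\mathcal C$ the function $(x,z)\mapsto\langle v^*,\Phi(x,z)\rangle+h(x)$ is convex on $\mathcal H\times\mathbb R^m$. Supremum function: $S^h_\Phi(x,z):=\sup\{\langle v^*,\Phi(x,z)\rangle+h(x): v^*\in\mathcal C\}$. Moreau envelope: for a proper convex lower semicontinuous function $f$ on a Hilbert space $X$ and $\lambda>0$, $\mathrm e_\lambda f(u):=\inf_{w\in X}\left(f(w)+\frac1{2\lambda}\|u-w\|^2\right)$. Here $\mathrm e_\lambda S^h_\Phi$ is taken on $X=\mathcal H\times\mathbb R^m$. $\xi:\Omega\to\mathbb R^m$ is a random vector on a probability space $(\Omega,\mathcal F,\mathbb P)$. Define $\varphi(x):=\mathbb P(\omega:\Phi(x,\xi(\omega))\in-\mathcal K)$ and $\varphi_\lambda(x):=\mathbb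 P(\omega:\mathrm e_\lambda S^h_\Phi(x,\xi(\omega))\le h(x))$.
   Formalization: The cone K is additionally assumed closed (a) and b) fail otherwise), and weak upper semicontinuity in d) is asserted only when h is sequentially weakly continuous (it fails e.g. for h=|x|^2, Φ=1-|x|^2 on l^2); norm upper semicontinuity is kept for every h. *)

theory Defs
  imports "HOL-Probability.Probability"
begin

(* The topology of pointwise convergence on bounded operators is the weak* topology
   when the codomain is the scalar field. *)
abbreviation weak_star_topology :: "('y::real_normed_vector \<Rightarrow>\<^sub>L real) topology" where
  "weak_star_topology \<equiv> strong_operator_topology"

definition dual_cone :: "'y::real_normed_vector set \<Rightarrow> ('y \<Rightarrow>\<^sub>L real) set" where
  "dual_cone K = {v. \<forall>y\<in>K. 0 \<le> blinfun_apply v y}"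

definition cone_gen :: "'a::real_vector set \<Rightarrow> 'a set" where
  "cone_gen C = {t *\<^sub>R c | t c. 0 \<le> t \<and> c \<in> C}"

definition continuously_differentiable :: "('a::real_normed_vector \<Rightarrow> real) \<Rightarrow> bool" where
  "continuously_differentiable h \<longleftrightarrow>
     (\<exists>h' :: 'a \<Rightarrow> 'a \<Rightarrow>\<^sub>L real.
        (\<forall>x. (h has_derivative blinfun_apply (h' x)) (at x)) \<and> continuous_on UNIV h')"

(* Values in ereal, so that the supremum and the infimum below are genuine ones, without
   any side condition of boundedness. *)
definition sup_fun ::
  "('y::real_normed_vector \<Rightarrow>\<^sub>L real) set \<Rightarrow> ('h \<times> 'z \<Rightarrow> 'y) \<Rightarrow> ('h \<Rightarrow> real) \<Rightarrow> 'h \<times> 'z \<Rightarrow> ereal" where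
  "sup_fun C \<Phi> h = (\<lambda>(x, z). SUP v\<in>C. ereal (blinfun_apply v (\<Phi> (x, z)) + h x))"

definition moreau_env :: "real \<Rightarrow> ('a::real_inner \<Rightarrow> ereal) \<Rightarrow> 'a \<Rightarrow> ereal" where
  "moreau_env l f u = (INF w. f w + ereal (1 / (2 * l) * (norm (u - w))\<^sup>2))"

definition prob_fun ::
  "'w measure \<Rightarrow> ('w \<Rightarrow> 'z) \<Rightarrow> 'y::real_normed_vector set \<Rightarrow> ('h \<times> 'z \<Rightarrow> 'y) \<Rightarrow> 'h \<Rightarrow> real" where
  "prob_fun M \<xi> K \<Phi> x = \<P>(\<omega> in M. \<Phi> (x, \<xi> \<omega>) \<in> uminus ` K)"

definition prob_fun_reg ::
  "'w measure \<Rightarrow> ('w \<Rightarrow> 'z::real_inner) \<Rightarrow> ('y::real_normed_vector \<Rightarrow>\<^sub>L real) set \<Rightarrow>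
   ('h::real_inner \<times> 'z \<Rightarrow> 'y) \<Rightarrow> ('h \<Rightarrow> real) \<Rightarrow> real \<Rightarrow> 'h \<Rightarrow> real" where
  "prob_fun_reg M \<xi> C \<Phi> h l x =
     \<P>(\<omega> in M. moreau_env l (sup_fun C \<Phi> h) (x, \<xi> \<omega>) \<le> ereal (h x))"

definition slater_set ::
  "('y::real_normed_vector \<Rightarrow>\<^sub>L real) set \<Rightarrow> ('h \<times> 'z \<Rightarrow> 'y) \<Rightarrow> ('h \<Rightarrow> real) \<Rightarrow> 'h set" where
  "slater_set C \<Phi> h = {x. \<exists>z. sup_fun C \<Phi> h (x, z) < ereal (h x)}"

definition weakly_tendsto :: "(nat \<Rightarrow> 'a::real_normed_vector) \<Rightarrow> 'a \<Rightarrow> bool" where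
  "weakly_tendsto X x \<longleftrightarrow>
     (\<forall>f :: 'a \<Rightarrow>\<^sub>L real. (\<lambda>k. blinfun_apply f (X k)) \<longlonglongrightarrow> blinfun_apply f x)"

definition seq_weakly_continuous :: "('a::real_normed_vector \<Rightarrow> real) \<Rightarrow> bool" where
  "seq_weakly_continuous f \<longleftrightarrow>
     (\<forall>X x. weakly_tendsto X x \<longrightarrow> (\<lambda>k. f (X k)) \<longlonglongrightarrow> f x)"

definition seq_weakly_usc :: "('a::real_normed_vector \<Rightarrow> real) \<Rightarrow> bool" where
  "seq_weakly_usc f \<longleftrightarrow>
     (\<forall>X x. weakly_tendsto X x \<longrightarrow> limsup (\<lambda>k. ereal (f (X k))) \<le> ereal (f x))"

definition seq_usc :: "('a::real_normed_vector \<Rightarrow> real) \<Rightarrow> bool" where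
  "seq_usc f \<longleftrightarrow>
     (\<forall>X x. X \<longlonglongrightarrow> x \<longrightarrow> limsup (\<lambda>k. ereal (f (X k))) \<le> ereal (f x))"

end

theory Submission
  imports Defs
begin

text \<open>Uniform boundedness makes the supremum function \<open>s\<close> finite, continuous and convex, and the
  bipolar theorem turns \<open>\<Phi> (x, z) \<in> - K\<close> into \<open>s (x, z) \<le> h x\<close>. Hence both probability functions are
  of the form \<open>x \<mapsto> P (g (x, \<xi>) \<le> h x)\<close> with \<open>g\<close> convex and continuous: \<open>g = s\<close> or \<open>g\<close> the Moreau
  envelope of \<open>s\<close>. A continuous subgradient of \<open>g\<close>, which Hahn-Banach provides, gives weak lower
  semicontinuity; applied to \<open>s\<close>, it also shows that the envelopes increase to \<open>s\<close> as the parameter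
  decreases to \<open>0\<close>. The upper limits then follow from Fatou's lemma for events. Under the Slater
  condition \<open>g (x, z) = h x\<close> holds only on the frontier of the convex set
  \<open>{z. g (x, z) \<le> h x}\<close>, which is Lebesgue null, so that upper limits become limits.\<close>

section \<open>Sublinear functionals and the Hahn-Banach theorem\<close>

definition sublinear :: "('a::real_vector \<Rightarrow> real) \<Rightarrow> bool" where
  "sublinear p \<longleftrightarrow> (\<forall>x y. p (x + y) \<le> p x + p y) \<and> (\<forall>t x. 0 \<le> t \<longrightarrow> p (t *\<^sub>R x) = t * p x)"

text \<open>The inequality for positive factors suffices: applied to \<open>inverse t\<close> and
  \<open>t *\<^sub>R x\<close> it gives the reverse inequality.\<close>

lemma sublinearI:
  assumes add: "\<And>x y. p (x + y) \<le> p x + p y"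
    and zero: "p 0 = 0"
    and scale: "\<And>t x. 0 < t \<Longrightarrow> p (t *\<^sub>R x) \<le> t * p x"
  shows "sublinear p"
  unfolding sublinear_def
proof (intro conjI allI impI)
  fix t :: real and x
  assume "0 \<le> t"
  show "p (t *\<^sub>R x) = t * p x"
  proof (cases "t = 0")
    case False
    with \<open>0 \<le> t\<close> have t: "0 < t" by simp
    have "p (inverse t *\<^sub>R (t *\<^sub>R x)) \<le> inverse t * p (t *\<^sub>R x)"
      by (rule scale) (use t in simp)
    then have "t * p x \<le> p (t *\<^sub>R x)"
      using t by (simp add: field_simps)
    with scale[OF t, of x] show ?thesis by simp
  qed (simp add: zero)
qed (rule add)

lemma sublinear_add: "sublinear p \<Longrightarrow> p (x + y) \<le> p x + p y"
  and sublinear_scaleR: "sublinear p \<Longrightarrow> 0 \<le> t \<Longrightarrow> p (t *\<^sub>R x) = t * p x"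
  unfolding sublinear_def by blast+

lemma sublinear_zero: "sublinear p \<Longrightarrow> p 0 = 0"
  using sublinear_scaleR[of p 0 0] by simp

lemma sublinear_minus_ge: "sublinear p \<Longrightarrow> - p (- x) \<le> p x"
  using sublinear_add[of p x "- x"] sublinear_zero[of p] by simp

text \<open>Lowers \<open>p\<close> just enough to make it linear along \<open>y\<close>; a minimal sublinear functional
  is therefore linear.\<close>
lemma sublinear_straighten:
  fixes p :: "'a::real_vector \<Rightarrow> real"
  assumes p: "sublinear p"
  obtains q where "sublinear q" "\<And>x. q x \<le> p x" "q (- y) \<le> - p y"
proof
  define T where "T x t = p (x + t *\<^sub>R y) - t * p y" for x t
  define q where "q x = (INF t\<in>{0..}. T x t)" for x
  \<comment> \<open>Subadditivity gives \<open>t * p y = p (t *\<^sub>R y) \<le> p (x + t *\<^sub>R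
    y) + p (- x)\<close>, so the infimum is finite.\<close>
  have T_ge: "- p (- x) \<le> T x t" if "0 \<le> t" for x t
    using sublinear_add[OF p, of "x + t *\<^sub>R y" "- x"] sublinear_scaleR[OF p that, of y]
    by (simp add: T_def)
  then have bdd: "bdd_below (T x ` {0..})" for x
    by (auto intro!: bdd_belowI)
  have q_le: "q x \<le> T x t" if "0 \<le> t" for x t
    unfolding q_def using bdd that by (intro cINF_lower) auto
  have q_ge: "c \<le> q x" if "\<And>t. 0 \<le> t \<Longrightarrow> c \<le> T x t" for c x
    unfolding q_def by (rule cINF_greatest) (use that in auto)
  show "sublinear q"
  proof (rule sublinearI)
    fix x x'
    \<comment> \<open>The two infima are taken one after the other: first over \<open>s\<close> with
      \<open>t\<close> fixed, then over \<open>t\<close>. The sum is tested at the parameter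
      \<open>s + t\<close>.\<close>
    have "q (x + x') - T x' t \<le> q x" if t: "0 \<le> t" for t
    proof (rule q_ge)
      fix s :: real assume s: "0 \<le> s"
      have "q (x + x') \<le> T (x + x') (s + t)" using s t by (intro q_le) simp
      also have "\<dots> \<le> T x s + T x' t"
        using sublinear_add[OF p, of "x + s *\<^sub>R y" "x' + t *\<^sub>R y"]
        by (simp add: T_def algebra_simps)
      finally show "q (x + x') - T x' t \<le> T x s" by simp
    qed
    then have "q (x + x') - q x \<le> q x'"
      by (intro q_ge) (smt (verit))
    then show "q (x + x') \<le> q x + q x'" by simp
  next
    have "T 0 t = 0" if "0 \<le> t" for t
      using sublinear_scaleR[OF p that, of y] by (simp add: T_def)
    then show "q 0 = 0"
      using q_le[of 0 0] q_ge[of 0 0] by fastforce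
  next
    fix t :: real and x assume t: "0 < t"
    have "q (t *\<^sub>R x) / t \<le> q x"
    proof (rule q_ge)
      fix s :: real assume s: "0 \<le> s"
      have "q (t *\<^sub>R x) \<le> T (t *\<^sub>R x) (t * s)" using s t by (intro q_le) simp
      also have "\<dots> = t * T x s"
        using sublinear_scaleR[OF p, of t "x + s *\<^sub>R y"] t
        by (simp add: T_def algebra_simps)
      finally show "q (t *\<^sub>R x) / t \<le> T x s" using t by (simp add: field_simps)
    qed
    then show "q (t *\<^sub>R x) \<le> t * q x" using t by (simp add: field_simps)
  qed
  show "q x \<le> p x" for x using q_le[of 0 x] by (simp add: T_def)
  \<comment> \<open>At \<open>t = 1\<close> the shift brings \<open>- y\<close> to \<open>0\<close>,
    and only \<open>- p y\<close> remains.\<close>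
  show "q (- y) \<le> - p y"
    using q_le[of 1 "- y"] sublinear_zero[OF p] by (simp add: T_def)
qed

text \<open>The pointwise infimum works; it is finite because every member lies above
  \<open>- p (- x)\<close>. For subadditivity, the smaller of two members of the chain bounds
  \<open>r (x + y)\<close> by its own values at \<open>x\<close> and \<open>y\<close>, hence by the
  mixed sum.\<close>

lemma sublinear_chain_lower_bound:
  fixes p :: "'a::real_vector \<Rightarrow> real"
  assumes sub: "\<And>q. q \<in> Q \<Longrightarrow> sublinear q \<and> q \<le> p"
    and chain: "\<And>q r. q \<in> Q \<Longrightarrow> r \<in> Q \<Longrightarrow> q \<le> r \<or> r \<le> q"
    and "Q \<noteq> {}"
  obtains r where "sublinear r" "r \<le> p" "\<And>q. q \<in> Q \<Longrightarrow> r \<le> q"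
proof
  define r where "r x = (INF q\<in>Q. q x)" for x
  have "- p (- x) \<le> q x" if "q \<in> Q" for q x
    using sublinear_minus_ge[of q x] sub[OF that] by (smt (verit) le_funD)
  then have "bdd_below ((\<lambda>q. q x) ` Q)" for x
    by (auto intro!: bdd_belowI)
  then have r_le: "r x \<le> q x" if "q \<in> Q" for q x
    unfolding r_def using that by (intro cINF_lower) auto
  have r_ge: "c \<le> r x" if "\<And>q. q \<in> Q \<Longrightarrow> c \<le> q x" for c x
    unfolding r_def by (rule cINF_greatest) (use that \<open>Q \<noteq> {}\<close> in auto)
  show "sublinear r"
  proof (rule sublinearI)
    fix x y
    have "r (x + y) \<le> q x + q' y" if "q \<in> Q" "q' \<in> Q" for q q'
      using chain[OF that] r_le[OF that(1), of "x + y"] r_le[OF that(2), of "x + y"]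
        sublinear_add[of q x y] sublinear_add[of q' x y] sub that
      by (smt (verit) le_funD)
    then have "r (x + y) - q' y \<le> r x" if "q' \<in> Q" for q'
      using that by (intro r_ge) (smt (verit))
    then have "r (x + y) - r x \<le> r y"
      by (intro r_ge) (smt (verit))
    then show "r (x + y) \<le> r x + r y" by simp
  next
    have "(\<lambda>q. q 0) ` Q = {0}"
      using sub \<open>Q \<noteq> {}\<close> sublinear_zero by force
    then show "r 0 = 0" by (simp add: r_def)
  next
    fix t :: real and x assume t: "0 < t"
    have "r (t *\<^sub>R x) / t \<le> r x"
    proof (rule r_ge)
      fix q assume q: "q \<in> Q"
      then show "r (t *\<^sub>R x) / t \<le> q x"
        using r_le[OF q, of "t *\<^sub>R x"] sublinear_scaleR[of q t x] sub[OF q] t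
        by (simp add: field_simps)
    qed
    then show "r (t *\<^sub>R x) \<le> t * r x" using t by (simp add: field_simps)
  qed
  show le: "r \<le> q" if "q \<in> Q" for q
    using r_le[OF that] by (simp add: le_fun_def)
  show "r \<le> p"
    using \<open>Q \<noteq> {}\<close> sub le by (meson all_not_in_conv order_trans)
qed

lemma sublinear_minimal:
  fixes p :: "'a::real_vector \<Rightarrow> real"
  assumes "sublinear p"
  obtains q where "sublinear q" "q \<le> p" "\<And>r. sublinear r \<Longrightarrow> r \<le> q \<Longrightarrow> r = q"
proof -
  define A where "A = {q. sublinear q \<and> q \<le> p}"
  have "\<exists>m\<in>A. \<forall>a\<in>A. a \<le> m \<longrightarrow> a = m"
  \<comment> \<open>The order is reversed, so that upper bounds of chains are pointwise lower bounds
    and a maximal element is a minimal functional.\<close>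
  proof (rule predicate_Zorn)
    show "partial_order_on A (relation_of (\<lambda>a b. b \<le> a) A)"
      by (rule partial_order_on_relation_ofI) auto
    fix Q assume "Q \<in> Chains (relation_of (\<lambda>a b. b \<le> a) A)"
    then have Q: "Q \<subseteq> A" "\<And>q r. q \<in> Q \<Longrightarrow> r \<in> Q \<Longrightarrow> q \<le> r \<or> r \<le> q"
      by (auto simp: Chains_def relation_of_def)
    show "\<exists>u\<in>A. \<forall>a\<in>Q. u \<le> a"
    proof (cases "Q = {}")
      case True
      then show ?thesis using assms by (auto simp: A_def)
    next
      case False
      have "sublinear q \<and> q \<le> p" if "q \<in> Q" for q
        using that Q(1) by (auto simp: A_def)
      then obtain r where "sublinear r" "r \<le> p" "\<And>q. q \<in> Q \<Longrightarrow> r \<le> q"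
        by (rule sublinear_chain_lower_bound[OF _ Q(2) False]) blast+
      then show ?thesis by (auto simp: A_def)
    qed
  qed
  then obtain m where m: "m \<in> A" "\<And>a. a \<in> A \<Longrightarrow> a \<le> m \<Longrightarrow> a = m" by blast
  show ?thesis
    by (rule that[of m]) (use m in \<open>auto simp: A_def\<close>)
qed

text \<open>Straightening along \<open>y\<close> first forces every linear functional below
  \<open>p'\<close> to take the value \<open>p y\<close> at \<open>y\<close>. A minimal
  \<open>f\<close> below \<open>p'\<close> is unchanged by straightening in any direction, so it is
  odd, and an odd sublinear functional is linear.\<close>

lemma hahn_banach_sublinear:
  fixes p :: "'a::real_vector \<Rightarrow> real"
  assumes p: "sublinear p"
  obtains f where "linear f" "\<And>x. f x \<le> p x" "f y = p y"
proof -
  obtain p' where p': "sublinear p'" "\<And>x. p' x \<le> p x" "p' (- y) \<le> - p y"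
    using sublinear_straighten[OF p] by blast
  obtain f where f: "sublinear f" "f \<le> p'" and min: "\<And>r. sublinear r \<Longrightarrow> r \<le> f \<Longrightarrow> r = f"
    using sublinear_minimal[OF p'(1)] by blast
  have neg: "f (- x) = - f x" for x
  proof -
    obtain r where r: "sublinear r" "\<And>z. r z \<le> f z" "r (- x) \<le> - f x"
      using sublinear_straighten[OF f(1)] by blast
    then have "r = f" by (intro min) (auto simp: le_fun_def)
    with r(3) show ?thesis using sublinear_minus_ge[OF f(1), of x] by simp
  qed
  have "linear f"
  proof (rule linearI)
    fix x z
    show "f (x + z) = f x + f z"
      using sublinear_add[OF f(1), of x z] sublinear_add[OF f(1), of "- x" "- z"]
        neg[of x] neg[of z] neg[of "x + z"] by simp
  next
    fix t :: real and x
    show "f (t *\<^sub>R x) = t *\<^sub>R f x"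
    proof (cases "0 \<le> t")
      case False
      then show ?thesis
        using sublinear_scaleR[OF f(1), of "- t" x] neg[of "t *\<^sub>R x"] by simp
    qed (simp add: sublinear_scaleR[OF f(1)])
  qed
  moreover have le: "f x \<le> p x" for x
    using f(2) p'(2) by (meson le_funD order_trans)
  moreover have "f y = p y"
    using le[of y] neg[of y] le_funD[OF f(2), of "- y"] p'(3) by simp
  ultimately show ?thesis by (rule that)
qed

text \<open>A one-sided bound on a ball is enough: scaling gives a bound everywhere, and the bound
  at \<open>- x\<close> makes it two-sided. Separation and subgradients both provide only such an
  upper bound.\<close>

lemma blinfun_of_linear_le:
  fixes f :: "'a::real_normed_vector \<Rightarrow> real"
  assumes f: "linear f" and le: "\<And>x. norm x \<le> d \<Longrightarrow> f x \<le> B" and d: "0 < d"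
  obtains F :: "'a \<Rightarrow>\<^sub>L real" where "blinfun_apply F = f"
proof -
  have "0 \<le> B" using le[of 0] d linear_0[OF f] by simp
  have "f x \<le> norm x * (B / d)" for x
  proof (cases "x = 0")
    case False
    have "f ((d / norm x) *\<^sub>R x) \<le> B"
      by (rule le) (use d False in simp)
    then show ?thesis using False d by (simp add: linear_scale[OF f] field_simps)
  qed (simp add: linear_0[OF f])
  from this this[of "- x" for x] have "norm (f x) \<le> norm x * (B / d)" for x
    by (smt (verit) linear_neg[OF f] norm_minus_cancel real_norm_def)
  then have "bounded_linear f"
    by (intro bounded_linear_intro[where K = "B / d"])
      (auto simp: linear_add[OF f] linear_scale[OF f])
  then show ?thesis
    by (intro that[of "Blinfun f"]) (simp add: bounded_linear_Blinfun_apply)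
qed

section \<open>Separation, subgradients and uniform boundedness\<close>

text \<open>Sums and positive multiples of points of a convex cone stay in it, so approximants of
  \<open>x\<close> and \<open>y\<close> combine to approximants of \<open>x + y\<close> and
  \<open>t *\<^sub>R x\<close>. The distance serves as the dominating functional for
  separation.\<close>

lemma sublinear_infdist:
  fixes K :: "'a::real_normed_vector set"
  assumes K: "convex_cone K"
  shows "sublinear (\<lambda>x. infdist x K)"
proof (rule sublinearI)
  have ne: "K \<noteq> {}" using K by (rule convex_cone_nonempty)
  fix x y :: 'a
  have "infdist (x + y) K \<le> dist x a + dist y b" if "a \<in> K" "b \<in> K" for a b
  proof -
    have "infdist (x + y) K \<le> dist (x + y) (a + b)"
      by (intro infdist_le convex_cone_add[OF K] that)
    also have "\<dots> \<le> dist x a + dist y b"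
      using norm_triangle_ineq[of "x - a" "y - b"] by (simp add: dist_norm algebra_simps)
    finally show ?thesis .
  qed
  then have "infdist (x + y) K - dist y b \<le> infdist x K" if "b \<in> K" for b
    unfolding infdist_notempty[OF ne, of x] using that
    by (intro cINF_greatest[OF ne]) (simp add: algebra_simps)
  then have "infdist (x + y) K - infdist x K \<le> infdist y K"
    unfolding infdist_notempty[OF ne, of y]
    by (intro cINF_greatest[OF ne]) (smt (verit))
  then show "infdist (x + y) K \<le> infdist x K + infdist y K" by simp
next
  show "infdist 0 K = 0" by (simp add: convex_cone_contains_0[OF K])
next
  fix t :: real and x :: 'a assume t: "0 < t"
  have ne: "K \<noteq> {}" using K by (rule convex_cone_nonempty)
  have "infdist (t *\<^sub>R x) K / t \<le> infdist x K"
    unfolding infdist_notempty[OF ne, of x]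
  proof (intro cINF_greatest[OF ne])
    fix a assume "a \<in> K"
    then have "infdist (t *\<^sub>R x) K \<le> dist (t *\<^sub>R x) (t *\<^sub>R a)"
      by (intro infdist_le convex_cone_scaleR[OF K]) (use t in auto)
    also have "\<dots> = t * dist x a"
      using t norm_scaleR[of t "x - a"] by (simp add: dist_norm scaleR_diff_right)
    finally show "infdist (t *\<^sub>R x) K / t \<le> dist x a" using t by (simp add: field_simps)
  qed
  then show "infdist (t *\<^sub>R x) K \<le> t * infdist x K" using t by (simp add: field_simps)
qed

text \<open>A linear functional below the distance to \<open>K\<close> is nonpositive on
  \<open>K\<close> and bounded by the norm. Chosen to agree with the distance at \<open>y\<close>,
  it is positive there because \<open>K\<close> is closed; its negative separates.\<close>

lemma separate_point_closed_convex_cone: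
  fixes K :: "'a::real_normed_vector set"
  assumes K: "convex_cone K" "closed K" and y: "y \<notin> K"
  obtains v where "v \<in> dual_cone K" "blinfun_apply v y < 0"
proof -
  obtain f where f: "linear f" "\<And>x. f x \<le> infdist x K" "f y = infdist y K"
    using hahn_banach_sublinear[OF sublinear_infdist[OF K(1)]] by blast
  have "f x \<le> norm x" for x
    using f(2)[of x] infdist_le[OF convex_cone_contains_0[OF K(1)], of x] by simp
  then have "f x \<le> 1" if "norm x \<le> 1" for x
    using that by (rule order_trans)
  then obtain F where F: "blinfun_apply F = f"
    using blinfun_of_linear_le[OF f(1), of 1 1] by auto
  have pos: "0 < f y"
    using infdist_pos_not_in_closed[OF K(2) convex_cone_nonempty[OF K(1)] y] f(3) by simp
  have nonpos: "f k \<le> 0" if "k \<in> K" for k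
    using f(2)[of k] that by simp
  show ?thesis
  proof (rule that)
    show "- F \<in> dual_cone K"
      unfolding dual_cone_def using nonpos by (simp add: blinfun.minus_left F)
    show "blinfun_apply (- F) y < 0"
      using pos by (simp add: blinfun.minus_left F)
  qed
qed

text \<open>The directional derivative \<open>p\<close> at \<open>u\<close>, written as the infimum
  of the difference quotients, is sublinear. Hahn-Banach yields a linear functional below it, and
  continuity of \<open>g\<close> at \<open>u\<close> bounds that functional near
  \<open>0\<close>.\<close>

lemma convex_continuous_subgradient:
  fixes g :: "'a::real_normed_vector \<Rightarrow> real"
  assumes g: "convex_on UNIV g" and cont: "continuous_on UNIV g"
  obtains F where "\<And>w. g u + blinfun_apply F (w - u) \<le> g w"
proof -
  define D where "D d t = (g (u + t *\<^sub>R d) - g u) / t" for d t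
  define p where "p d = (INF t\<in>{0<..}. D d t)" for d
  have D_ge: "g u - g (u - d) \<le> D d t" if t: "0 < t" for d t
  proof -
    \<comment> \<open>With this weight \<open>u\<close> is a convex combination of
      \<open>u + t *\<^sub>R d\<close> and \<open>u - d\<close>, which bounds the quotients from
      below.\<close>
    define a where "a = t / (1 + t)"
    have a: "0 \<le> a" "a \<le> 1" "(1 - a) * t = a" using t by (simp_all add: a_def field_simps)
    have "(1 - a) *\<^sub>R (u + t *\<^sub>R d) + a *\<^sub>R (u - d) = u + ((1 - a) * t) *\<^sub>R d - a *\<^sub>R d"
      by (simp add: algebra_simps)
    then have "g u \<le> (1 - a) * g (u + t *\<^sub>R d) + a * g (u - d)"
      using convex_onD[OF g, of a "u + t *\<^sub>R d" "u - d"] a by simp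
    also have "\<dots> = (g (u + t *\<^sub>R d) + t * g (u - d)) / (1 + t)"
    proof -
      have "1 - a = 1 / (1 + t)" using t by (simp add: a_def field_simps)
      then show ?thesis by (simp add: a_def add_divide_distrib)
    qed
    finally have "g u \<le> (g (u + t *\<^sub>R d) + t * g (u - d)) / (1 + t)" .
    then have "g u * (1 + t) \<le> g (u + t *\<^sub>R d) + t * g (u - d)"
      using t by (simp add: pos_le_divide_eq)
    then show ?thesis using t by (simp add: D_def field_simps)
  qed
  then have bdd: "bdd_below (D d ` {0<..})" for d
    by (auto intro!: bdd_belowI)
  have p_le: "p d \<le> D d t" if "0 < t" for d t
    unfolding p_def using bdd that by (intro cINF_lower) auto
  have p_ge: "c \<le> p d" if "\<And>t. 0 < t \<Longrightarrow> c \<le> D d t" for c d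
    unfolding p_def by (rule cINF_greatest) (use that in auto)
  have "sublinear p"
  proof (rule sublinearI)
    fix d e
    have "p (d + e) - D e t \<le> p d" if t: "0 < t" for t
    proof (rule p_ge)
      fix s :: real assume s: "0 < s"
      \<comment> \<open>The weight \<open>a\<close> gives both directions the same length
        \<open>r\<close>, so \<open>u + r *\<^sub>R (d + e)\<close> is a convex combination of
        \<open>u + s *\<^sub>R d\<close> and \<open>u + t *\<^sub>R e\<close>.\<close>
      define a r where "a = s / (s + t)" and "r = s * t / (s + t)"
      have a: "0 \<le> a" "a \<le> 1" "(1 - a) * s = r" "a * t = r" and r: "0 < r"
        using s t by (simp_all add: a_def r_def field_simps)
      have "(1 - a) *\<^sub>R (u + s *\<^sub>R d) + a *\<^sub>R (u + t *\<^sub>R e)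
        = u + ((1 - a) * s) *\<^sub>R d + (a * t) *\<^sub>R e"
        by (simp add: algebra_simps)
      also have "\<dots> = u + r *\<^sub>R (d + e)"
        unfolding a by (simp add: algebra_simps)
      finally have "g (u + r *\<^sub>R (d + e)) \<le> (1 - a) * g (u + s *\<^sub>R d) + a * g (u + t *\<^sub>R e)"
        using convex_onD[OF g, of a "u + s *\<^sub>R d" "u + t *\<^sub>R e"] a by simp
      then have "g (u + r *\<^sub>R (d + e)) - g u
          \<le> (1 - a) * (g (u + s *\<^sub>R d) - g u) + a * (g (u + t *\<^sub>R e) - g u)"
        by (simp add: algebra_simps)
      also have "\<dots> = ((1 - a) * s) * D d s + (a * t) * D e t"
        using s t by (simp add: D_def)
      also have "\<dots> = (D d s + D e t) * r"
        unfolding a by (simp add: algebra_simps)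
      finally have "D (d + e) r \<le> D d s + D e t"
        using r unfolding D_def[of "d + e"] by (simp add: pos_divide_le_eq)
      with p_le[OF r, of "d + e"] show "p (d + e) - D e t \<le> D d s" by simp
    qed
    then have "p (d + e) - p d \<le> p e"
      by (intro p_ge) (smt (verit))
    then show "p (d + e) \<le> p d + p e" by simp
  next
    show "p 0 = 0" by (simp add: p_def D_def)
  next
    fix t :: real and d assume t: "0 < t"
    have "p (t *\<^sub>R d) / t \<le> p d"
    proof (rule p_ge)
      fix s :: real assume s: "0 < s"
      have "p (t *\<^sub>R d) \<le> D (t *\<^sub>R d) (s / t)" using s t by (intro p_le) simp
      also have "\<dots> = t * D d s" using t by (simp add: D_def)
      finally show "p (t *\<^sub>R d) / t \<le> D d s" using t by (simp add: field_simps)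
    qed
    then show "p (t *\<^sub>R d) \<le> t * p d" using t by (simp add: field_simps)
  qed
  then obtain f where f: "linear f" "\<And>d. f d \<le> p d"
    using hahn_banach_sublinear by blast
  have f_le: "f d \<le> g (u + d) - g u" for d
    using f(2)[of d] p_le[of 1 d] by (simp add: D_def)
  have "isCont g u" using cont by (simp add: continuous_on_eq_continuous_at)
  then obtain \<delta> where \<delta>: "0 < \<delta>" "\<And>w. dist w u < \<delta> \<Longrightarrow> dist (g w) (g u) < 1"
    unfolding continuous_at_eps_delta by (metis zero_less_one)
  have "f d \<le> 1" if "norm d \<le> \<delta> / 2" for d
  proof -
    have "dist (g (u + d)) (g u) < 1"
      using that \<delta>(1) by (intro \<delta>(2)) (simp add: dist_norm)
    then show ?thesis using f_le[of d] by (simp add: dist_real_def)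
  qed
  then obtain F where F: "blinfun_apply F = f"
    using blinfun_of_linear_le[OF f(1), of "\<delta> / 2" 1] \<delta>(1) by auto
  show ?thesis
    by (rule that[of F]) (use f_le[of "w - u" for w] in \<open>simp add: F\<close>, smt (verit))
qed

section \<open>Weak convergence and weak lower semicontinuity\<close>

lemma weakly_tendsto_of_tendsto: "X \<longlonglongrightarrow> x \<Longrightarrow> weakly_tendsto X x"
  unfolding weakly_tendsto_def by (auto intro: tendsto_intros)

text \<open>A functional on the product is a functional of the first coordinate plus the constant
  \<open>f (0, z)\<close>.\<close>

lemma weakly_tendsto_Pair:
  fixes X :: "nat \<Rightarrow> 'a::real_normed_vector" and z :: "'b::real_normed_vector"
  assumes "weakly_tendsto X x"
  shows "weakly_tendsto (\<lambda>k. (X k, z)) (x, z)"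
  unfolding weakly_tendsto_def
proof
  fix f :: "('a \<times> 'b) \<Rightarrow>\<^sub>L real"
  define e where "e = f o\<^sub>L Blinfun (\<lambda>x::'a. (x, 0::'b))"
  have "bounded_linear (\<lambda>x::'a. (x, 0::'b))"
    by (intro bounded_linear_Pair bounded_linear_ident bounded_linear_zero)
  then have split: "f (a, z) = e a + f (0, z)" for a
    by (simp add: e_def bounded_linear_Blinfun_apply flip: blinfun.add_right)
  have "(\<lambda>k. e (X k)) \<longlonglongrightarrow> e x" using assms by (auto simp: weakly_tendsto_def)
  then have "(\<lambda>k. e (X k) + f (0, z)) \<longlonglongrightarrow> e x + f (0, z)"
    by (rule tendsto_add[OF _ tendsto_const])
  then show "(\<lambda>k. f (X k, z)) \<longlonglongrightarrow> f (x, z)"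
    by (simp only: split[symmetric])
qed

text \<open>The subgradient at \<open>u\<close> gives an affine minorant that touches
  \<open>g\<close> at \<open>u\<close> and is weakly continuous.\<close>

lemma convex_continuous_weakly_lsc:
  fixes g :: "'a::real_normed_vector \<Rightarrow> real"
  assumes "convex_on UNIV g" "continuous_on UNIV g" and U: "weakly_tendsto U u" and c: "c < g u"
  shows "\<forall>\<^sub>F k in sequentially. c < g (U k)"
proof -
  obtain F where F: "\<And>w. g u + blinfun_apply F (w - u) \<le> g w"
    using convex_continuous_subgradient[OF assms(1,2)] by blast
  have "(\<lambda>k. blinfun_apply F (U k)) \<longlonglongrightarrow> blinfun_apply F u"
    using U by (simp add: weakly_tendsto_def)
  then have "\<forall>\<^sub>F k in sequentially. blinfun_apply F u - (g u - c) < blinfun_apply F (U k)"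
    by (rule order_tendstoD) (use c in simp)
  then show ?thesis
  proof eventually_elim
    case (elim k)
    then show ?case using F[of "U k"] by (simp add: blinfun.diff_right)
  qed
qed

text \<open>Banach-Steinhaus by Baire category: the closed sets \<open>F n\<close> cover the space,
  so one of them contains a ball.\<close>

lemma uniform_boundedness_functionals:
  fixes C :: "('y::banach \<Rightarrow>\<^sub>L real) set"
  assumes pw: "\<And>y. \<exists>b. \<forall>v\<in>C. \<bar>blinfun_apply v y\<bar> \<le> b"
  obtains B where "\<And>v. v \<in> C \<Longrightarrow> norm v \<le> B"
proof -
  define F where "F n = {y. \<forall>v\<in>C. \<bar>blinfun_apply v y\<bar> \<le> real n}" for n
  have closed: "closed (F n)" for n
    unfolding F_def Collect_ball_eq
    by (intro closed_INT ballI closed_Collect_le continuous_intros)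
  have "y \<in> \<Union>(range F)" for y
  proof -
    obtain b where b: "\<forall>v\<in>C. \<bar>blinfun_apply v y\<bar> \<le> b" using pw by blast
    obtain n where "b \<le> real n" using real_arch_simple by blast
    with b have "y \<in> F n" unfolding F_def by (blast intro: order_trans)
    then show ?thesis by blast
  qed
  then have "\<Union>(range F) = UNIV" by blast
  then have "euclidean interior_of \<Union>(range F) \<noteq> {}" by simp
  then obtain n where "interior (F n) \<noteq> {}"
    using Baire_category_alt[of "euclidean :: 'y topology" "range F"] closed
      completely_metrizable_space_euclidean by (auto simp: closed_closedin[symmetric])
  then obtain y e where e: "0 < e" "cball y e \<subseteq> F n"
    by (metis all_not_in_conv mem_interior_cball)
  have "norm v \<le> 2 * real n / e" if v: "v \<in> C" for v
  proof (rule norm_blinfun_bound)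
    show "0 \<le> 2 * real n / e" using e by simp
    fix w
    show "norm (blinfun_apply v w) \<le> 2 * real n / e * norm w"
    proof (cases "w = 0")
      case False
      let ?w = "(e / norm w) *\<^sub>R w"
      \<comment> \<open>Both the centre and the shifted point lie in the ball, so by subtraction
        \<open>v\<close> is at most \<open>2 * n\<close> in absolute value on vectors of norm
        \<open>e\<close>.\<close>
      have "y \<in> F n" "y + ?w \<in> F n"
        using e False by (auto simp: dist_norm intro!: subsetD[OF e(2)])
      then have "\<bar>blinfun_apply v y\<bar> \<le> n" "\<bar>blinfun_apply v (y + ?w)\<bar> \<le> n"
        using v by (auto simp: F_def)
      then have "\<bar>blinfun_apply v ?w\<bar> \<le> 2 * n" by (simp add: blinfun.add_right)
      then show ?thesis using e False by (simp add: blinfun.scaleR_right abs_mult field_simps)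
    qed simp
  qed
  then show ?thesis by (rule that)
qed

section \<open>The Moreau envelope\<close>

text \<open>Real-valued counterpart of \<open>moreau_env\<close>. Being a real infimum, it is
  meaningful where the objective is bounded below; \<open>moreau_env_ereal\<close> then identifies
  the two.\<close>

definition real_env :: "real \<Rightarrow> ('a::real_inner \<Rightarrow> real) \<Rightarrow> 'a \<Rightarrow> real" where
  "real_env l f u = (INF w. f w + 1 / (2 * l) * (norm (u - w))\<^sup>2)"

text \<open>A subgradient of norm \<open>b\<close> at \<open>u\<close> costs at most
  \<open>max\<^sub>r (b r - r\<^sup>2 / (2 l)) = l b\<^sup>2 / 2\<close>.\<close>
lemma moreau_objective_ge:
  fixes f :: "'a::real_inner \<Rightarrow> real"
  assumes "convex_on UNIV f" "continuous_on UNIV f"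
  shows "\<exists>b. \<forall>l>0. \<forall>w. f u - l * b \<le> f w + 1 / (2 * l) * (norm (u - w))\<^sup>2"
proof -
  obtain F where F: "\<And>w. f u + blinfun_apply F (w - u) \<le> f w"
    using convex_continuous_subgradient[OF assms] by blast
  \<comment> \<open>The constant \<open>(norm F)\<^sup>2 / 2\<close> depends neither on
    \<open>l\<close> nor on \<open>w\<close>; this uniformity lets the gap vanish as
    \<open>l\<close> tends to \<open>0\<close>.\<close>
  have "f u - l * ((norm F)\<^sup>2 / 2) \<le> f w + 1 / (2 * l) * (norm (u - w))\<^sup>2" if l: "0 < l" for l w
  proof -
    define r where "r = norm (u - w)"
    have "\<bar>blinfun_apply F (w - u)\<bar> \<le> norm F * r"
      using norm_blinfun[of F "w - u"] by (simp add: r_def norm_minus_commute)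
    then have "f u - norm F * r \<le> f w" using F[of w] by linarith
    \<comment> \<open>Completing the square: expanding this term yields the bound on
      \<open>norm F * r\<close> below.\<close>
    moreover have "0 \<le> (r - l * norm F)\<^sup>2 / (2 * l)" using l by simp
    then have "norm F * r \<le> l * ((norm F)\<^sup>2 / 2) + 1 / (2 * l) * r\<^sup>2"
      using l by (simp add: power2_eq_square field_simps)
    ultimately show ?thesis unfolding r_def by linarith
  qed
  then show ?thesis by blast
qed

section \<open>Convexity, continuity and convergence of the envelope\<close>

lemma convex_on_power2_norm: "convex_on UNIV (\<lambda>x::'a::real_inner. (norm x)\<^sup>2)"
proof (rule convex_onI)
  fix t :: real and x y :: 'a
  assume t: "0 < t" "t < 1"
  have "(1 - t) * (norm x)\<^sup>2 + t * (norm y)\<^sup>2 - (norm ((1 - t) *\<^sub>R x + t *\<^sub>R y))\<^sup>2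
    = t * (1 - t) * (norm (x - y))\<^sup>2"
    unfolding power2_norm_eq_inner
    by (simp add: inner_simps inner_commute algebra_simps)
  also have "0 \<le> \<dots>" using t by simp
  finally show "(norm ((1 - t) *\<^sub>R x + t *\<^sub>R y))\<^sup>2 \<le> (1 - t) * (norm x)\<^sup>2 + t * (norm y)\<^sup>2" by simp
qed simp

text \<open>A convex function that is bounded above near a point is bounded there on both sides and
  hence continuous. Here the upper bound comes from the continuous majorant; for the envelope the
  majorant is the function itself.\<close>

lemma convex_on_dominated_imp_continuous:
  fixes g :: "'a::real_normed_vector \<Rightarrow> real"
  assumes g: "convex_on UNIV g" and f: "continuous_on UNIV f" and le: "\<And>x. g x \<le> f x"
  shows "continuous_on UNIV g"
proof -
  have "isCont g x" for x
  proof -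
    have "isCont f x" using f by (simp add: continuous_on_eq_continuous_at)
    then obtain \<delta> where \<delta>: "0 < \<delta>" "\<And>w. dist w x < \<delta> \<Longrightarrow> dist (f w) (f x) < 1"
      unfolding continuous_at_eps_delta by (metis zero_less_one)
    have "g y \<le> f x + 1" if "y \<in> cball x (\<delta> / 2)" for y
    proof -
      have "dist (f y) (f x) < 1" using that \<delta>(1) by (intro \<delta>(2)) (simp add: dist_commute)
      then show ?thesis using le[of y] by (simp add: dist_real_def)
    qed
    then have "\<bar>g y\<bar> \<le> f x + 1 + 2 * \<bar>g x\<bar>" if "y \<in> cball x (\<delta> / 2)" for y
      using that convex_on_subset[OF g] by (intro convex_bounds_lemma[of x "\<delta> / 2"]) auto
    then have "continuous_on (ball x (\<delta> / 2)) g"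
      using convex_on_subset[OF g]
      by (intro convex_on_bounded_continuous[of _ _ "f x + 1 + 2 * \<bar>g x\<bar>"]) auto
    then show ?thesis using \<delta>(1) by (simp add: continuous_on_eq_continuous_at)
  qed
  then show ?thesis by (simp add: continuous_on_eq_continuous_at)
qed

context
  fixes f :: "'a::real_inner \<Rightarrow> real"
  assumes f: "convex_on UNIV f" "continuous_on UNIV f"
begin

lemma bdd_below_moreau_objective:
  assumes "0 < l"
  shows "bdd_below (range (\<lambda>w. f w + 1 / (2 * l) * (norm (u - w))\<^sup>2))"
proof -
  obtain b where b: "\<And>l w. 0 < l \<Longrightarrow> f u - l * b \<le> f w + 1 / (2 * l) * (norm (u - w))\<^sup>2"
    using moreau_objective_ge[OF f, of u] by blast
  show ?thesis by (rule bdd_belowI2) (rule b[OF assms])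
qed

lemma real_env_le_objective: "0 < l \<Longrightarrow> real_env l f u \<le> f w + 1 / (2 * l) * (norm (u - w))\<^sup>2"
  unfolding real_env_def by (rule cINF_lower[OF bdd_below_moreau_objective]) auto

lemma real_env_greatest:
  "(\<And>w. c \<le> f w + 1 / (2 * l) * (norm (u - w))\<^sup>2) \<Longrightarrow> c \<le> real_env l f u"
  unfolding real_env_def by (rule cINF_greatest) auto

lemma real_env_le: "0 < l \<Longrightarrow> real_env l f u \<le> f u"
  using real_env_le_objective[of l u u] by simp

lemma real_env_antimono:
  assumes "0 < l" "l \<le> m"
  shows "real_env m f u \<le> real_env l f u"
proof (rule real_env_greatest)
  fix w
  have "1 / (2 * m) * (norm (u - w))\<^sup>2 \<le> 1 / (2 * l) * (norm (u - w))\<^sup>2"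
    using assms by (intro mult_right_mono) (auto simp: field_simps)
  with real_env_le_objective[of m u w] assms
  show "real_env m f u \<le> f w + 1 / (2 * l) * (norm (u - w))\<^sup>2" by simp
qed

lemma moreau_env_ereal:
  assumes l: "0 < l"
  shows "moreau_env l (\<lambda>w. ereal (f w)) u = ereal (real_env l f u)"
proof (rule antisym)
  show "ereal (real_env l f u) \<le> moreau_env l (\<lambda>w. ereal (f w)) u"
    unfolding moreau_env_def using real_env_le_objective[OF l] by (auto intro!: INF_greatest)
  show "moreau_env l (\<lambda>w. ereal (f w)) u \<le> ereal (real_env l f u)"
  proof (rule ereal_le_epsilon2)
    fix e :: real assume "0 < e"
    then obtain w where "f w + 1 / (2 * l) * (norm (u - w))\<^sup>2 < real_env l f u + e"
      using real_env_greatest[of "real_env l f u + e" l u] by (smt (verit))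
    then show "moreau_env l (\<lambda>w. ereal (f w)) u \<le> ereal (real_env l f u) + ereal e"
      unfolding moreau_env_def by (intro INF_lower2[of w]) auto
  qed
qed

text \<open>The objective is jointly convex in the point and the competitor, and partial
  minimisation of a jointly convex function is convex.\<close>

lemma convex_on_real_env:
  assumes l: "0 < l"
  shows "convex_on UNIV (real_env l f)"
proof (rule convex_onI)
  fix t :: real and u v
  assume t: "0 < t" "t < 1"
  define Q where "Q u w = f w + 1 / (2 * l) * (norm (u - w))\<^sup>2" for u w
  let ?E = "real_env l f ((1 - t) *\<^sub>R u + t *\<^sub>R v)"
  have greatest: "c \<le> real_env l f u" if "\<And>w. c \<le> Q u w" for c u
    using that unfolding Q_def by (rule real_env_greatest)
  \<comment> \<open>The competitor for the combined point is the same convex combination of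
    \<open>w\<close> and \<open>z\<close>.\<close>
  have joint: "?E \<le> (1 - t) * Q u w + t * Q v z" for w z
  proof -
    define \<kappa> where "\<kappa> = 1 / (2 * l)"
    have \<kappa>: "0 \<le> \<kappa>" using l by (simp add: \<kappa>_def)
    have "((1 - t) *\<^sub>R u + t *\<^sub>R v) - ((1 - t) *\<^sub>R w + t *\<^sub>R z) = (1 - t) *\<^sub>R (u - w) + t *\<^sub>R (v - z)"
      by (simp add: algebra_simps)
    then have "?E \<le> f ((1 - t) *\<^sub>R w + t *\<^sub>R z) + \<kappa> * (norm ((1 - t) *\<^sub>R (u - w) + t *\<^sub>R (v - z)))\<^sup>2"
      using real_env_le_objective[OF l] unfolding \<kappa>_def by metis
    also have "\<dots> \<le> ((1 - t) * f w + t * f z)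
        + \<kappa> * ((1 - t) * (norm (u - w))\<^sup>2 + t * (norm (v - z))\<^sup>2)"
      using t \<kappa> by (intro add_mono mult_left_mono convex_onD[OF f(1)]
          convex_onD[OF convex_on_power2_norm]) auto
    also have "\<dots> = (1 - t) * Q u w + t * Q v z"
      unfolding Q_def \<kappa>_def[symmetric] by (simp add: algebra_simps)
    finally show ?thesis .
  qed
  \<comment> \<open>The infimum over \<open>w\<close> is taken first with \<open>z\<close> fixed,
    then the one over \<open>z\<close>; dividing by the positive weights isolates \<open>Q\<close>
    each time.\<close>
  have "(?E - t * Q v z) / (1 - t) \<le> real_env l f u" for z
    by (rule greatest)
      (use joint[of _ z] t in \<open>simp add: pos_divide_le_eq mult.commute diff_le_eq\<close>)
  then have "?E - t * Q v z \<le> (1 - t) * real_env l f u" for z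
    using t by (simp add: pos_divide_le_eq mult.commute)
  then have "(?E - (1 - t) * real_env l f u) / t \<le> Q v z" for z
    using t by (simp add: pos_divide_le_eq) (smt (verit) mult.commute)
  then have "(?E - (1 - t) * real_env l f u) / t \<le> real_env l f v"
    by (rule greatest)
  then show "?E \<le> (1 - t) * real_env l f u + t * real_env l f v"
    using t by (simp add: pos_divide_le_eq mult.commute diff_le_eq add.commute)
qed simp

lemma continuous_on_real_env:
  assumes "0 < l"
  shows "continuous_on UNIV (real_env l f)"
  using convex_on_real_env[OF assms] f(2) real_env_le[OF assms]
  by (rule convex_on_dominated_imp_continuous)

lemma real_env_approx:
  assumes c: "c < f u"
  obtains l where "0 < l" "c < real_env l f u"
proof -
  obtain b where b: "\<And>l w. 0 < l \<Longrightarrow> f u - l * b \<le> f w + 1 / (2 * l) * (norm (u - w))\<^sup>2"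
    using moreau_objective_ge[OF f, of u] by blast
  \<comment> \<open>\<open>d\<close> is a positive bound for \<open>b\<close>, so that dividing by
    it is safe; the next choice of \<open>l\<close> makes the loss \<open>l * b\<close> at most half
    of the gap \<open>f u - c\<close>.\<close>
  define d where "d = \<bar>b\<bar> + 1"
  have d: "b \<le> d" "0 < d" by (auto simp: d_def)
  define l where "l = (f u - c) / (2 * d)"
  have l: "0 < l" using c d by (simp add: l_def)
  have "l * b \<le> l * d" using l d by (intro mult_left_mono) auto
  also have "\<dots> = (f u - c) / 2" using d by (simp add: l_def)
  finally have "c < f u - l * b" using c by (simp add: field_simps)
  also have "\<dots> \<le> real_env l f u" by (rule real_env_greatest) (rule b[OF l])
  finally show ?thesis using l by (intro that)
qed

text \<open>One fixed envelope with parameter \<open>m\<close> already exceeds \<open>c\<close> at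
  \<open>u\<close> and is weakly lower semicontinuous. Once \<open>l k < m\<close>, the envelope for
  \<open>l k\<close> lies above it.\<close>

lemma real_env_liminf:
  assumes l: "\<And>k. 0 < l k" "l \<longlonglongrightarrow> 0" and U: "weakly_tendsto U u" and c: "c < f u"
  shows "\<forall>\<^sub>F k in sequentially. c < real_env (l k) f (U k)"
proof -
  obtain m where m: "0 < m" "c < real_env m f u" using real_env_approx[OF c] by blast
  have "\<forall>\<^sub>F k in sequentially. c < real_env m f (U k)"
    using convex_on_real_env continuous_on_real_env U m by (intro convex_continuous_weakly_lsc) auto
  moreover have "\<forall>\<^sub>F k in sequentially. l k < m" using l(2) m(1) by (rule order_tendstoD)
  ultimately show ?thesis
  proof eventually_elim
    case (elim k)
    then show ?case using real_env_antimono[OF l(1)[of k], of m "U k"] by simp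
  qed
qed

end

section \<open>Probabilities of sublevel sets\<close>

context prob_space
begin

text \<open>The tail unions \<open>U n\<close> decrease to the event that \<open>A k\<close> occurs
  infinitely often, which lies in \<open>B\<close> almost surely; continuity from above
  concludes.\<close>

lemma limsup_prob_le:
  assumes A: "\<And>k. {\<omega> \<in> space M. A k \<omega>} \<in> events" and B: "{\<omega> \<in> space M. B \<omega>} \<in> events"
    and AE: "AE \<omega> in M. (\<exists>\<^sub>F k in sequentially. A k \<omega>) \<longrightarrow> B \<omega>"
  shows "limsup (\<lambda>k. ereal (\<P>(\<omega> in M. A k \<omega>))) \<le> ereal (\<P>(\<omega> in M. B \<omega>))"
proof -
  define U where "U n = (\<Union>k\<in>{n..}. {\<omega> \<in> space M. A k \<omega>})" for n
  have U: "U n \<in> events" for n unfolding U_def using A by auto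
  have le: "\<P>(\<omega> in M. A n \<omega>) \<le> prob (U n)" for n
    by (intro finite_measure_mono U) (auto simp: U_def)
  have "(\<lambda>n. prob (U n)) \<longlonglongrightarrow> prob (\<Inter>n. U n)"
  proof (rule finite_Lim_measure_decseq)
    show "range U \<subseteq> events" using U by blast
    show "decseq U" unfolding decseq_def U_def by (intro allI impI UN_mono) auto
  qed
  then have lim: "limsup (\<lambda>n. ereal (prob (U n))) = ereal (prob (\<Inter>n. U n))"
    by (intro lim_imp_Limsup) auto
  have "limsup (\<lambda>k. ereal (\<P>(\<omega> in M. A k \<omega>))) \<le> limsup (\<lambda>n. ereal (prob (U n)))"
    using le by (intro Limsup_mono) auto
  also have "\<dots> = ereal (prob (\<Inter>n. U n))" by (rule lim)
  also have "prob (\<Inter>n. U n) \<le> \<P>(\<omega> in M. B \<omega>)"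
  proof (rule finite_measure_mono_AE[OF _ B])
    show "AE \<omega> in M. \<omega> \<in> (\<Inter>n. U n) \<longrightarrow> \<omega> \<in> {\<omega> \<in> space M. B \<omega>}"
      using AE by eventually_elim (auto simp: U_def frequently_sequentially)
  qed
  finally show ?thesis by simp
qed

text \<open>The two almost sure implications say that the indicators of \<open>A k\<close> are
  eventually equal to that of \<open>B\<close>, so dominated convergence applies.\<close>

lemma tendsto_prob:
  assumes A: "\<And>k. {\<omega> \<in> space M. A k \<omega>} \<in> events" and B: "{\<omega> \<in> space M. B \<omega>} \<in> events"
    and AE1: "AE \<omega> in M. (\<exists>\<^sub>F k in sequentially. A k \<omega>) \<longrightarrow> B \<omega>"
    and AE2: "AE \<omega> in M. B \<omega> \<longrightarrow> (\<forall>\<^sub>F k in sequentially. A k \<omega>)"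
  shows "(\<lambda>k. \<P>(\<omega> in M. A k \<omega>)) \<longlonglongrightarrow> \<P>(\<omega> in M. B \<omega>)"
proof -
  have "(\<lambda>k. \<integral>\<omega>. indicator {\<omega> \<in> space M. A k \<omega>} \<omega> \<partial>M)
      \<longlonglongrightarrow> (\<integral>\<omega>. indicator {\<omega> \<in> space M. B \<omega>} \<omega> \<partial>M :: real)"
  proof (rule integral_dominated_convergence[where w = "\<lambda>_. 1"])
    show "AE \<omega> in M. (\<lambda>k. indicator {\<omega> \<in> space M. A k \<omega>} \<omega> :: real)
        \<longlonglongrightarrow> indicator {\<omega> \<in> space M. B \<omega>} \<omega>"
      using AE1 AE2 AE_space
    proof eventually_elim
      case (elim \<omega>)
      then have "\<forall>\<^sub>F k in sequentially. A k \<omega> \<longleftrightarrow> B \<omega>"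
        by (cases "B \<omega>") (auto simp: not_frequently)
      then show ?case
        by (intro tendsto_eventually) (auto elim!: eventually_mono simp: indicator_def)
    qed
  qed (use A B in \<open>auto intro!: AE_I2 simp: indicator_def\<close>)
  then show ?thesis using A B by (simp add: sets.Int_space_eq2 Int_absorb2 sets.sets_into_space)
qed

end

text \<open>If a point of level \<open>c\<close> were interior to the sublevel set, the segment from
  \<open>z0\<close> could be prolonged beyond it inside that set, and convexity with
  \<open>g z0 < c\<close> would force a value below \<open>c\<close>. So the level set lies in the
  frontier of a convex set, which is negligible.\<close>

lemma AE_convex_neq_level:
  fixes g :: "'a::euclidean_space \<Rightarrow> real"
  assumes g: "convex_on UNIV g" "continuous_on UNIV g" and slater: "g z0 < c"
  shows "AE z in lborel. g z \<noteq> c"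
proof -
  let ?S = "{z. g z \<le> c}"
  have sub: "{z. g z = c} \<subseteq> frontier ?S"
  proof
    fix z assume "z \<in> {z. g z = c}"
    then have z: "g z = c" by simp
    have "z \<notin> interior ?S"
    proof
      assume "z \<in> interior ?S"
      then obtain e where e: "0 < e" "cball z e \<subseteq> ?S" by (meson mem_interior_cball)
      \<comment> \<open>The step keeps \<open>w\<close> within distance \<open>e\<close> of
        \<open>z\<close>; the summand \<open>1\<close> keeps the denominator positive.\<close>
      define s where "s = e / (norm (z - z0) + 1)"
      have s: "0 < s" using e by (simp add: s_def add_nonneg_pos)
      define w where "w = z + s *\<^sub>R (z - z0)"
      have "norm (s *\<^sub>R (z - z0)) \<le> e"
      proof -
        have "s * (norm (z - z0) + 1) = e" by (simp add: s_def add_nonneg_eq_0_iff)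
        then have "s * norm (z - z0) \<le> e" using s by (simp add: distrib_left)
        then show ?thesis using s by (simp only: norm_scaleR abs_of_pos)
      qed
      then have "g w \<le> c"
        using subsetD[OF e(2), of w] by (simp add: w_def dist_norm)
      \<comment> \<open>This weight solves \<open>(1 - a) * s = a\<close>, which makes
        \<open>z\<close> the combination of \<open>w\<close> and \<open>z0\<close> with weights
        \<open>1 - a\<close> and \<open>a\<close>.\<close>
      define a where "a = s / (1 + s)"
      have a: "0 < a" "a < 1" "(1 - a) * s = a" using s by (auto simp: a_def field_simps)
      have "(1 - a) *\<^sub>R w + a *\<^sub>R z0 = z + ((1 - a) * s) *\<^sub>R (z - z0) - a *\<^sub>R (z - z0)"
        by (simp add: w_def algebra_simps)
      then have "g z \<le> (1 - a) * g w + a * g z0"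
        using convex_onD[OF g(1), of a w z0] a by simp
      also have "\<dots> < (1 - a) * c + a * c"
        using a slater \<open>g w \<le> c\<close> by (intro add_le_less_mono mult_left_mono mult_strict_left_mono) auto
      finally show False using z by (simp add: algebra_simps)
    qed
    then show "z \<in> frontier ?S"
      using closure_subset[of ?S] z by (auto simp: frontier_def)
  qed
  have "convex ?S" 
  proof (rule convexI)
    fix x y and u v :: real
    assume xy: "x \<in> ?S" "y \<in> ?S" and uv: "0 \<le> u" "0 \<le> v" "u + v = 1"
    then have "g (u *\<^sub>R x + v *\<^sub>R y) \<le> u * g x + v * g y"
      using g(1) by (auto simp: convex_on_def)
    also have "\<dots> \<le> c" using xy uv by (intro convex_bound_le) auto
    finally show "u *\<^sub>R x + v *\<^sub>R y \<in> ?S" by simp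
  qed
  then have "negligible {z. g z = c}"
    using sub by (blast intro: negligible_subset negligible_convex_frontier)
  then have "{z. g z = c} \<in> null_sets lebesgue" by (simp add: negligible_iff_null_sets)
  \<comment> \<open>Closedness makes the set Borel, so a null set of the completed measure is a null
    set of \<open>lborel\<close>.\<close>
  moreover have "closed {z. g z = c}" using g(2) by (intro closed_Collect_eq) auto
  ultimately have "{z. g z = c} \<in> null_sets lborel"
    by (simp add: null_sets_completion_iff borel_closed)
  then show ?thesis by (rule AE_I') simp
qed

lemma AE_distributed_lborel:
  assumes "distributed M lborel \<xi> dens" and P: "AE z in lborel. P z"
  shows "AE \<omega> in M. P (\<xi> \<omega>)"
proof -
  have \<xi>: "\<xi> \<in> measurable M lborel" and [measurable]: "dens \<in> borel_measurable lborel"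
    and distr: "distr M lborel \<xi> = density lborel dens"
    using assms(1) by (auto simp: distributed_def)
  have "AE z in distr M lborel \<xi>. P z"
    unfolding distr using P by (subst AE_density) auto
  then show ?thesis by (rule AE_distrD[OF \<xi>])
qed

section \<open>Level probabilities: a common form for both probability functions\<close>

definition level_prob ::
  "'w measure \<Rightarrow> ('w \<Rightarrow> 'z) \<Rightarrow> ('h \<times> 'z \<Rightarrow> real) \<Rightarrow> ('h \<Rightarrow> real) \<Rightarrow> 'h \<Rightarrow> real" where
  "level_prob M \<xi> g h x = \<P>(\<omega> in M. g (x, \<xi> \<omega>) \<le> h x)"

lemma continuous_on_slice:
  assumes "continuous_on UNIV g"
  shows "continuous_on UNIV (\<lambda>z. g (x, z))"
  using assms by (rule continuous_on_compose2) (auto intro!: continuous_intros)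

lemma convex_on_slice:
  assumes "convex_on UNIV g"
  shows "convex_on UNIV (\<lambda>z. g (x, z))"
proof (rule convex_onI)
  fix t :: real and y z
  assume "0 < t" "t < 1"
  then show "g (x, (1 - t) *\<^sub>R y + t *\<^sub>R z) \<le> (1 - t) * g (x, y) + t * g (x, z)"
    using convex_onD[OF assms, of t "(x, y)" "(x, z)"] by (simp flip: scaleR_add_left)
qed simp

text \<open>Otherwise some \<open>c\<close> strictly between \<open>\<beta>\<close> and
  \<open>\<alpha>\<close> would eventually separate \<open>b k\<close> from
  \<open>a k\<close>.\<close>

lemma frequently_level_imp:
  fixes a b :: "nat \<Rightarrow> real"
  assumes freq: "\<exists>\<^sub>F k in sequentially. a k \<le> b k" and "b \<longlonglongrightarrow> \<beta>"
    and low: "\<And>c. c < \<alpha> \<Longrightarrow> \<forall>\<^sub>F k in sequentially. c < a k"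
  shows "\<alpha> \<le> \<beta>"
proof (rule ccontr)
  assume "\<not> \<alpha> \<le> \<beta>"
  then obtain c where c: "\<beta> < c" "c < \<alpha>" using dense by (meson not_le)
  have "\<forall>\<^sub>F k in sequentially. b k < c" using assms(2) c(1) by (rule order_tendstoD)
  with low[OF c(2)] have "\<forall>\<^sub>F k in sequentially. \<not> a k \<le> b k"
    by eventually_elim simp
  with freq show False by (simp add: frequently_def)
qed

context prob_space
begin

lemma sets_level:
  fixes g :: "'h::real_normed_vector \<times> 'z::euclidean_space \<Rightarrow> real"
  assumes "\<xi> \<in> borel_measurable M" "continuous_on UNIV g"
  shows "{\<omega> \<in> space M. g (x, \<xi> \<omega>) \<le> c} \<in> events"
proof -
  have "(\<lambda>z. g (x, z)) \<in> borel_measurable borel"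
    using continuous_on_slice[OF assms(2)] by (rule borel_measurable_continuous_onI)
  then have [measurable]: "(\<lambda>\<omega>. g (x, \<xi> \<omega>)) \<in> borel_measurable M"
    using measurable_compose[OF assms(1)] by blast
  show ?thesis by measurable
qed

text \<open>The functions \<open>G k\<close> may vary, which covers both a fixed \<open>g\<close>
  and envelopes with vanishing parameters. For each fixed \<open>z\<close>, the lower bound
  \<open>low\<close> carries infinitely many of the inequalities over to the limit.\<close>

lemma limsup_level_prob_le:
  fixes g :: "'h::real_normed_vector \<times> 'z::euclidean_space \<Rightarrow> real"
  assumes \<xi>: "\<xi> \<in> borel_measurable M"
    and cont: "continuous_on UNIV g" "\<And>k. continuous_on UNIV (G k)"
    and h: "(\<lambda>k. h (X k)) \<longlonglongrightarrow> h x"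
    and low: "\<And>z c. c < g (x, z) \<Longrightarrow> \<forall>\<^sub>F k in sequentially. c < G k (X k, z)"
  shows "limsup (\<lambda>k. ereal (level_prob M \<xi> (G k) h (X k))) \<le> ereal (level_prob M \<xi> g h x)"
proof -
  have imp: "g (x, z) \<le> h x" if "\<exists>\<^sub>F k in sequentially. G k (X k, z) \<le> h (X k)" for z
    using that h low by (rule frequently_level_imp)
  show ?thesis
    unfolding level_prob_def
    by (intro limsup_prob_le sets_level[OF \<xi>] cont AE_I2 impI) (rule imp)
qed

text \<open>The Slater point makes the boundary case \<open>g (x, z) = h x\<close> a null event.
  Away from it the inequality is strict, and \<open>upp\<close> makes it persist for all large
  \<open>k\<close>.\<close>

lemma tendsto_level_prob:
  fixes g :: "'h::real_normed_vector \<times> 'z::euclidean_space \<Rightarrow> real"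
  assumes \<xi>: "distributed M lborel \<xi> dens"
    and cont: "continuous_on UNIV g" "\<And>k. continuous_on UNIV (G k)"
    and conv: "convex_on UNIV g" and slater: "g (x, z0) < h x"
    and h: "(\<lambda>k. h (X k)) \<longlonglongrightarrow> h x"
    and low: "\<And>z c. c < g (x, z) \<Longrightarrow> \<forall>\<^sub>F k in sequentially. c < G k (X k, z)"
    and upp: "\<And>z c. g (x, z) < c \<Longrightarrow> \<forall>\<^sub>F k in sequentially. G k (X k, z) < c"
  shows "(\<lambda>k. level_prob M \<xi> (G k) h (X k)) \<longlonglongrightarrow> level_prob M \<xi> g h x"
proof -
  have meas: "\<xi> \<in> borel_measurable M" using \<xi> by (simp add: distributed_def)
  have "AE z in lborel. g (x, z) \<noteq> h x"
    using convex_on_slice[OF conv] continuous_on_slice[OF cont(1)] slater by (rule AE_convex_neq_level)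
  then have neq: "AE \<omega> in M. g (x, \<xi> \<omega>) \<noteq> h x" by (rule AE_distributed_lborel[OF \<xi>])
  have ev: "\<forall>\<^sub>F k in sequentially. G k (X k, z) \<le> h (X k)" if less: "g (x, z) < h x" for z
  proof -
    obtain c where c: "g (x, z) < c" "c < h x" using dense[OF less] by blast
    have "\<forall>\<^sub>F k in sequentially. c < h (X k)" using h c(2) by (rule order_tendstoD)
    with upp[OF c(1)] show ?thesis by eventually_elim simp
  qed
  have imp: "g (x, z) \<le> h x" if "\<exists>\<^sub>F k in sequentially. G k (X k, z) \<le> h (X k)" for z
    using that h low by (rule frequently_level_imp)
  show ?thesis
    unfolding level_prob_def
  proof (rule tendsto_prob)
    show "AE \<omega> in M. (\<exists>\<^sub>F k in sequentially. G k (X k, \<xi> \<omega>) \<le> h (X k)) \<longrightarrow> g (x, \<xi> \<omega>) \<le> h x"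
      by (intro AE_I2 impI) (rule imp)
    show "AE \<omega> in M. g (x, \<xi> \<omega>) \<le> h x \<longrightarrow> (\<forall>\<^sub>F k in sequentially. G k (X k, \<xi> \<omega>) \<le> h (X k))"
      using neq by eventually_elim (auto intro: ev)
  qed (intro sets_level[OF meas] cont)+
qed

end

section \<open>The supremum function\<close>

text \<open>Evaluation at a vector is weak* continuous, so \<open>C\<close> is pointwise bounded,
  and by uniform boundedness it is bounded in norm by some \<open>B\<close>. Hence the supremum is
  finite; it inherits convexity from its members and continuity from a modulus common to all of
  them.\<close>

lemma sup_fun_real:
  fixes C :: "('y::banach \<Rightarrow>\<^sub>L real) set"
    and \<Phi> :: "'h::real_normed_vector \<times> 'z::real_normed_vector \<Rightarrow> 'y"
  assumes C: "compactin weak_star_topology C" "C \<noteq> {}"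
    and \<Phi>: "continuous_on UNIV \<Phi>" and h: "continuous_on UNIV h"
    and conv: "\<And>v. v \<in> C \<Longrightarrow> convex_on UNIV (\<lambda>(x, z). blinfun_apply v (\<Phi> (x, z)) + h x)"
  obtains s where "sup_fun C \<Phi> h = (\<lambda>u. ereal (s u))" "convex_on UNIV s" "continuous_on UNIV s"
proof -
  have "\<exists>b. \<forall>v\<in>C. \<bar>blinfun_apply v y\<bar> \<le> b" for y
  proof -
    have "compact ((\<lambda>v. blinfun_apply v y) ` C)"
      using image_compactin[OF C(1) strong_operator_topology_continuous_evaluation[of y]] by simp
    then show ?thesis using compact_imp_bounded by (fastforce simp: bounded_iff)
  qed
  then obtain B where B: "\<And>v. v \<in> C \<Longrightarrow> norm v \<le> B"
    using uniform_boundedness_functionals[of C] by blast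
  have vB: "blinfun_apply v y \<le> B * norm y" if "v \<in> C" for v y
    using norm_blinfun[of v y] mult_right_mono[OF B[OF that], of "norm y"] by simp
  define T where "T v u = blinfun_apply v (\<Phi> u) + h (fst u)" for v u
  define s where "s u = (SUP v\<in>C. T v u)" for u
  have "T v u \<le> B * norm (\<Phi> u) + h (fst u)" if "v \<in> C" for v u
    using vB[OF that] by (simp add: T_def)
  then have bdd: "bdd_above ((\<lambda>v. T v u) ` C)" for u
    by (rule bdd_aboveI2)
  have s_ge: "T v u \<le> s u" if "v \<in> C" for v u
    unfolding s_def using that bdd by (rule cSUP_upper)
  have s_le: "s u \<le> c" if "\<And>v. v \<in> C \<Longrightarrow> T v u \<le> c" for u c
    unfolding s_def by (rule cSUP_least) (use C(2) that in auto)
  have "sup_fun C \<Phi> h u = ereal (s u)" for u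
  proof -
    have eq: "sup_fun C \<Phi> h u = (SUP v\<in>C. ereal (T v u))"
      by (simp add: sup_fun_def T_def split_beta)
    show ?thesis unfolding eq
    proof (rule antisym)
      show "(SUP v\<in>C. ereal (T v u)) \<le> ereal (s u)"
        using s_ge by (intro SUP_least) simp
      show "ereal (s u) \<le> (SUP v\<in>C. ereal (T v u))"
      proof (rule ereal_le_epsilon2)
        fix e :: real assume "0 < e"
        then obtain v where v: "v \<in> C" "s u < T v u + e"
          using s_le[of u "s u - e"] by (smt (verit))
        then have "ereal (s u) \<le> ereal (T v u) + ereal e" by simp
        also have "\<dots> \<le> (SUP v\<in>C. ereal (T v u)) + ereal e"
          using v(1) by (intro add_right_mono SUP_upper)
        finally show "ereal (s u) \<le> (SUP v\<in>C. ereal (T v u)) + ereal e" .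
      qed
    qed
  qed
  moreover have "convex_on UNIV s"
  proof (rule convex_onI)
    fix t :: real and u w :: "'h \<times> 'z"
    assume t: "0 < t" "t < 1"
    show "s ((1 - t) *\<^sub>R u + t *\<^sub>R w) \<le> (1 - t) * s u + t * s w"
    proof (rule s_le)
      fix v assume v: "v \<in> C"
      have "convex_on UNIV (T v)"
        using conv[OF v] by (simp add: T_def[abs_def] split_beta')
      then have "T v ((1 - t) *\<^sub>R u + t *\<^sub>R w) \<le> (1 - t) * T v u + t * T v w"
        using t by (intro convex_onD) auto
      also have "\<dots> \<le> (1 - t) * s u + t * s w"
        using t s_ge[OF v] by (intro add_mono mult_left_mono) auto
      finally show "T v ((1 - t) *\<^sub>R u + t *\<^sub>R w) \<le> (1 - t) * s u + t * s w" .
    qed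
  qed simp
  moreover have "continuous_on UNIV s"
  proof -
    \<comment> \<open>The estimate is uniform in \<open>v\<close> and so survives the supremum;
      exchanging \<open>u\<close> and \<open>w\<close> gives the bound on the absolute
      value.\<close>
    have diff: "s w - s u \<le> B * norm (\<Phi> w - \<Phi> u) + \<bar>h (fst w) - h (fst u)\<bar>" for u w
    proof -
      have "T v w \<le> s u + B * norm (\<Phi> w - \<Phi> u) + \<bar>h (fst w) - h (fst u)\<bar>" if "v \<in> C" for v
        using s_ge[OF that, of u] vB[OF that, of "\<Phi> w - \<Phi> u"]
        by (simp add: T_def blinfun.diff_right)
      then have "s w \<le> s u + B * norm (\<Phi> w - \<Phi> u) + \<bar>h (fst w) - h (fst u)\<bar>"
        by (rule s_le)
      then show ?thesis by simp
    qed
    have "((\<lambda>w. s w - s u) \<longlongrightarrow> 0) (at u)" for u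
    proof (rule Lim_null_comparison)
      show "\<forall>\<^sub>F w in at u. norm (s w - s u) \<le> B * norm (\<Phi> w - \<Phi> u) + \<bar>h (fst w) - h (fst u)\<bar>"
        using diff[of _ u] diff[of u]
        by (intro always_eventually allI) (simp add: abs_le_iff norm_minus_commute abs_minus_commute)
      have \<Phi>u: "(\<Phi> \<longlongrightarrow> \<Phi> u) (at u)"
        using \<Phi> unfolding continuous_on_def by blast
      have "isCont h (fst u)" using h by (simp add: continuous_on_eq_continuous_at)
      then have hu: "((\<lambda>w. h (fst w)) \<longlongrightarrow> h (fst u)) (at u)"
        by (rule isCont_tendsto_compose) (intro tendsto_intros)
      have "((\<lambda>w. B * norm (\<Phi> w - \<Phi> u) + \<bar>h (fst w) - h (fst u)\<bar>)
          \<longlongrightarrow> B * norm (\<Phi> u - \<Phi> u) + \<bar>h (fst u) - h (fst u)\<bar>) (at u)"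
        by (intro tendsto_intros \<Phi>u hu)
      then show "((\<lambda>w. B * norm (\<Phi> w - \<Phi> u) + \<bar>h (fst w) - h (fst u)\<bar>) \<longlongrightarrow> 0) (at u)"
        by simp
    qed
    then have "(s \<longlongrightarrow> s u) (at u)" for u
      by (rule LIM_zero_cancel)
    then show ?thesis unfolding continuous_on_def by blast
  qed
  ultimately show ?thesis by (intro that[of s]) auto
qed

text \<open>The bipolar theorem. Testing on \<open>C\<close> is as good as testing on
  \<open>dual_cone K\<close>, because the half-space \<open>?H\<close> is weak* closed and contains
  \<open>cone_gen C\<close> as soon as it contains \<open>C\<close>. Separation then recovers the
  closed cone \<open>K\<close> from its dual.\<close>

lemma mem_uminus_cone_iff:
  fixes K :: "'y::real_normed_vector set"
  assumes K: "convex_cone K" "closed K"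
    and gen: "weak_star_topology closure_of (cone_gen C) = dual_cone K"
  shows "y \<in> uminus ` K \<longleftrightarrow> (\<forall>v\<in>C. blinfun_apply v y \<le> 0)"
proof
  assume "y \<in> uminus ` K"
  then have y: "- y \<in> K" by auto
  show "\<forall>v\<in>C. blinfun_apply v y \<le> 0"
  proof
    fix v assume "v \<in> C"
    then have "1 *\<^sub>R v \<in> cone_gen C" unfolding cone_gen_def by fastforce
    then have "v \<in> dual_cone K"
      using closure_of_subset[of "cone_gen C" weak_star_topology]
      by (auto simp: gen strong_operator_topology_topspace)
    then have "0 \<le> blinfun_apply v (- y)" using y by (simp add: dual_cone_def)
    then show "blinfun_apply v y \<le> 0" by (simp add: blinfun.minus_right)
  qed
next
  assume neg: "\<forall>v\<in>C. blinfun_apply v y \<le> 0"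
  let ?H = "{v. blinfun_apply v y \<le> 0}"
  have "closedin weak_star_topology {v \<in> topspace weak_star_topology. blinfun_apply v y \<in> {..0}}"
    by (rule closedin_continuous_map_preimage[OF strong_operator_topology_continuous_evaluation]) simp
  then have "closedin weak_star_topology ?H" by (simp add: strong_operator_topology_topspace)
  moreover have "cone_gen C \<subseteq> ?H"
    using neg by (auto simp: cone_gen_def blinfun.scaleR_left mult_nonneg_nonpos)
  ultimately have dual: "dual_cone K \<subseteq> ?H"
    unfolding gen[symmetric] by (intro closure_of_minimal)
  have "- y \<in> K"
  proof (rule ccontr)
    assume "- y \<notin> K"
    then obtain v where "v \<in> dual_cone K" "blinfun_apply v (- y) < 0"
      using separate_point_closed_convex_cone[OF K] by blast
    then show False using dual by (auto simp: blinfun.minus_right)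
  qed
  then show "y \<in> uminus ` K" by force
qed

text \<open>The real summand \<open>h x\<close> cancels in each inequality under the supremum, which
  leaves the criterion of \<open>mem_uminus_cone_iff\<close>.\<close>

lemma prob_fun_eq_level_prob:
  assumes "convex_cone K" "closed K" "weak_star_topology closure_of (cone_gen C) = dual_cone K"
    and s: "sup_fun C \<Phi> h = (\<lambda>u. ereal (s u))"
  shows "prob_fun M \<xi> K \<Phi> = level_prob M \<xi> s h"
proof -
  have "\<Phi> (x, z) \<in> uminus ` K \<longleftrightarrow> s (x, z) \<le> h x" for x z
  proof -
    have "s (x, z) \<le> h x \<longleftrightarrow> sup_fun C \<Phi> h (x, z) \<le> ereal (h x)" by (simp add: s)
    also have "\<dots> \<longleftrightarrow> (\<forall>v\<in>C. blinfun_apply v (\<Phi> (x, z)) \<le> 0)"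
      by (simp add: sup_fun_def SUP_le_iff)
    finally show ?thesis using mem_uminus_cone_iff[OF assms(1-3)] by simp
  qed
  then show ?thesis by (simp add: prob_fun_def level_prob_def fun_eq_iff)
qed

lemma prob_fun_reg_eq_level_prob:
  assumes "sup_fun C \<Phi> h = (\<lambda>u. ereal (s u))" "convex_on UNIV s" "continuous_on UNIV s" "0 < l"
  shows "prob_fun_reg M \<xi> C \<Phi> h l = level_prob M \<xi> (real_env l s) h"
  unfolding prob_fun_reg_def[abs_def] level_prob_def[abs_def] assms(1)
    moreau_env_ereal[OF assms(2-4)] ereal_less_eq(3) ..

text \<open>The inequalities compare with \<open>h (X k)\<close>, which must tend to
  \<open>h x\<close>. Weakly convergent sequences therefore come with weak sequential continuity of
  \<open>h\<close>, while for norm convergence its continuity provides the limit.\<close>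

theorem theorem3p1:
  fixes M :: "'w measure"
    and \<xi> :: "'w \<Rightarrow> real ^ 'm"
    and dens :: "real ^ 'm \<Rightarrow> ennreal"
    and K :: "'y::banach set"
    and C :: "('y \<Rightarrow>\<^sub>L real) set"
    and \<Phi> :: "'h::{real_inner, complete_space} \<times> (real ^ 'm) \<Rightarrow> 'y"
    and h :: "'h \<Rightarrow> real"
  assumes "separable_space (euclidean :: 'h topology)"
    and "convex_cone K" and "closed K"
    and "convex C" and "compactin weak_star_topology C"
    and "weak_star_topology closure_of (cone_gen C) = dual_cone K"
    and "continuous_on UNIV \<Phi>"
    and "continuously_differentiable h" and "convex_on UNIV h"
    and "\<And>v. v \<in> C \<Longrightarrow> convex_on UNIV (\<lambda>(x, z). blinfun_apply v (\<Phi> (x, z)) + h x)"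
    and "prob_space M"
    and "distributed M lborel \<xi> dens"
  shows
    "((\<forall>l1 l2 x. l1 > l2 \<and> l2 > 0 \<longrightarrow>
          prob_fun_reg M \<xi> C \<Phi> h l1 x \<ge> prob_fun_reg M \<xi> C \<Phi> h l2 x) \<and>
      (\<forall>x. (INF l\<in>{0<..}. prob_fun_reg M \<xi> C \<Phi> h l x) = prob_fun M \<xi> K \<Phi> x))
   \<and> ((\<forall>l X x. (\<forall>k. l k > 0) \<and> l \<longlonglongrightarrow> 0 \<and> X \<longlonglongrightarrow> x \<longrightarrow>
          limsup (\<lambda>k. ereal (prob_fun_reg M \<xi> C \<Phi> h (l k) (X k))) \<le> ereal (prob_fun M \<xi> K \<Phi> x)) \<and>
      (seq_weakly_continuous h \<longrightarrow>
        (\<forall>l X x. (\<forall>k. l k > 0) \<and> l \<longlonglongrightarrow> 0 \<and> weakly_tendsto X x \<longrightarrow>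
          limsup (\<lambda>k. ereal (prob_fun_reg M \<xi> C \<Phi> h (l k) (X k))) \<le> ereal (prob_fun M \<xi> K \<Phi> x))))
   \<and> (open (slater_set C \<Phi> h) \<and>
      (\<forall>l X x. (\<forall>k. l k > 0) \<and> l \<longlonglongrightarrow> 0 \<and> X \<longlonglongrightarrow> x \<and> x \<in> slater_set C \<Phi> h \<longrightarrow>
          (\<lambda>k. prob_fun_reg M \<xi> C \<Phi> h (l k) (X k)) \<longlonglongrightarrow> prob_fun M \<xi> K \<Phi> x))
   \<and> ((seq_weakly_continuous h \<longrightarrow>
        seq_weakly_usc (prob_fun M \<xi> K \<Phi>) \<and>
        (\<forall>l>0. seq_weakly_usc (prob_fun_reg M \<xi> C \<Phi> h l))) \<and>
      seq_usc (prob_fun M \<xi> K \<Phi>) \<and>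
      (\<forall>l>0. seq_usc (prob_fun_reg M \<xi> C \<Phi> h l)))
   \<and> (continuous_on (slater_set C \<Phi> h) (prob_fun M \<xi> K \<Phi>) \<and>
      (\<forall>l>0. continuous_on (slater_set C \<Phi> h) (prob_fun_reg M \<xi> C \<Phi> h l)))"
proof -
  interpret prob_space M by fact
  have meas: "\<xi> \<in> borel_measurable M" using assms(12) by (simp add: distributed_def)
  have "isCont h x" for x
    using assms(8) has_derivative_continuous unfolding continuously_differentiable_def by blast
  then have contH: "continuous_on UNIV h"
    by (simp add: continuous_at_imp_continuous_on)
  \<comment> \<open>The dual cone contains \<open>0\<close>, whereas the closure of the empty set is
    empty. Nonemptiness of \<open>C\<close> keeps the supremum from being minus infinity.\<close>
  have "cone_gen C \<noteq> {}"
  proof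
    assume "cone_gen C = {}"
    moreover have "0 \<in> dual_cone K" by (simp add: dual_cone_def)
    ultimately show False using assms(6) by simp
  qed
  then have "C \<noteq> {}" by (auto simp: cone_gen_def)
  then obtain s where s: "sup_fun C \<Phi> h = (\<lambda>u. ereal (s u))" "convex_on UNIV s" "continuous_on UNIV s"
    using sup_fun_real[OF assms(5) _ assms(7) contH assms(10)] by blast
  have P: "prob_fun M \<xi> K \<Phi> = level_prob M \<xi> s h"
    using prob_fun_eq_level_prob assms(2,3,6) s(1) by blast
  have R: "prob_fun_reg M \<xi> C \<Phi> h l = level_prob M \<xi> (real_env l s) h" if "0 < l" for l
    using prob_fun_reg_eq_level_prob s that by blast
  have D: "slater_set C \<Phi> h = {x. \<exists>z. s (x, z) < h x}"
    by (simp add: slater_set_def s(1))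
  have env: "convex_on UNIV (real_env l s)" "continuous_on UNIV (real_env l s)" if "0 < l" for l
    using convex_on_real_env continuous_on_real_env s(2,3) that by blast+
  have hX: "(\<lambda>k. h (X k)) \<longlonglongrightarrow> h x" if "X \<longlonglongrightarrow> x" for X x
    using contH that by (auto intro: continuous_on_tendsto_compose)
  have upper: "\<forall>\<^sub>F k in sequentially. g (X k, z) < c"
    if "continuous_on UNIV g" "X \<longlonglongrightarrow> x" "g (x, z) < c"
    for X x z c and g :: "'h \<times> (real ^ 'm) \<Rightarrow> real"
  proof -
    have "(\<lambda>k. g (X k, z)) \<longlonglongrightarrow> g (x, z)"
      by (rule continuous_on_tendsto_compose[OF that(1)]) (auto intro!: tendsto_intros that(2))
    then show ?thesis using that(3) by (rule order_tendstoD)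
  qed
  have lower: "\<forall>\<^sub>F k in sequentially. c < g (X k, z)"
    if "convex_on UNIV g" "continuous_on UNIV g" "weakly_tendsto X x" "c < g (x, z)"
    for X x z c and g :: "'h \<times> (real ^ 'm) \<Rightarrow> real"
    using that(1,2) weakly_tendsto_Pair[OF that(3)] that(4) by (rule convex_continuous_weakly_lsc)
  have usc: "limsup (\<lambda>k. ereal (level_prob M \<xi> g h (X k))) \<le> ereal (level_prob M \<xi> g h x)"
    if g: "convex_on UNIV g" "continuous_on UNIV g"
      and X: "weakly_tendsto X x" "(\<lambda>k. h (X k)) \<longlonglongrightarrow> h x" for g X x
    using g(2) g(2) X(2) lower[OF g X(1)] by (rule limsup_level_prob_le[OF meas])
  \<comment> \<open>A Slater point for \<open>s\<close> is one for every \<open>g\<close> below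
    \<open>s\<close>, so this covers \<open>s\<close> itself and all its envelopes.\<close>
  have cont: "continuous_on (slater_set C \<Phi> h) (level_prob M \<xi> g h)"
    if g: "convex_on UNIV g" "continuous_on UNIV g" "\<And>u. g u \<le> s u" for g
    unfolding continuous_on_sequentially
  proof (intro ballI allI impI)
    fix x X assume x: "x \<in> slater_set C \<Phi> h" and "(\<forall>n. X n \<in> slater_set C \<Phi> h) \<and> X \<longlonglongrightarrow> x"
    then have X: "X \<longlonglongrightarrow> x" by blast
    obtain z0 where "s (x, z0) < h x" using x D by auto
    then have "g (x, z0) < h x" using g(3)[of "(x, z0)"] by simp
    then have "(\<lambda>k. level_prob M \<xi> g h (X k)) \<longlonglongrightarrow> level_prob M \<xi> g h x"
      using hX[OF X] lower[OF g(1,2) weakly_tendsto_of_tendsto[OF X]] upper[OF g(2) X]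
      by (rule tendsto_level_prob[OF assms(12) g(2) g(2) g(1)])
    then show "(level_prob M \<xi> g h \<circ> X) \<longlonglongrightarrow> level_prob M \<xi> g h x"
      by (simp add: o_def)
  qed
  have usc_reg: "limsup (\<lambda>k. ereal (prob_fun_reg M \<xi> C \<Phi> h (l k) (X k))) \<le> ereal (prob_fun M \<xi> K \<Phi> x)"
    if l: "\<And>k. 0 < l k" "l \<longlonglongrightarrow> 0" and X: "weakly_tendsto X x" "(\<lambda>k. h (X k)) \<longlonglongrightarrow> h x" for l X x
    unfolding P R[OF l(1)]
    using s(3) env(2)[OF l(1)] X(2) real_env_liminf[OF s(2,3) l weakly_tendsto_Pair[OF X(1)]]
    by (rule limsup_level_prob_le[OF meas])
  have mono: "prob_fun_reg M \<xi> C \<Phi> h l x \<le> prob_fun_reg M \<xi> C \<Phi> h m x" if "0 < l" "l < m" for l m x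
  proof -
    \<comment> \<open>A larger parameter lowers the envelope and so enlarges its sublevel
      set.\<close>
    have "real_env m s u \<le> real_env l s u" for u
      using that by (intro real_env_antimono s) auto
    then show ?thesis
      using that R[of l] R[of m] unfolding level_prob_def
      by (auto intro!: finite_measure_mono sets_level[OF meas] env intro: order_trans)
  qed
  have ge: "prob_fun M \<xi> K \<Phi> x \<le> prob_fun_reg M \<xi> C \<Phi> h l x" if "0 < l" for l x
    using real_env_le[OF s(2,3) that] that R[of l] unfolding P level_prob_def
    by (auto intro!: finite_measure_mono sets_level[OF meas] env intro: order_trans)
  have INF: "(INF l\<in>{0<..}. prob_fun_reg M \<xi> C \<Phi> h l x) = prob_fun M \<xi> K \<Phi> x" (is "?I = _") for x
  proof (rule antisym)
    have bdd: "bdd_below ((\<lambda>l. prob_fun_reg M \<xi> C \<Phi> h l x) ` {0<..})"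
      using ge by (auto intro!: bdd_belowI2)
    \<comment> \<open>Any positive null sequence serves here; the upper limit estimate is applied to
      it with the constant sequence at \<open>x\<close>.\<close>
    define l where "l k = 1 / real (Suc k)" for k
    have l: "0 < l k" for k by (simp add: l_def)
    have "l \<longlonglongrightarrow> 0" unfolding l_def by (rule LIMSEQ_Suc[OF lim_const_over_n])
    then have "limsup (\<lambda>k. ereal (prob_fun_reg M \<xi> C \<Phi> h (l k) x)) \<le> ereal (prob_fun M \<xi> K \<Phi> x)"
      by (intro usc_reg l weakly_tendsto_of_tendsto tendsto_const)
    moreover have "ereal ?I \<le> limsup (\<lambda>k. ereal (prob_fun_reg M \<xi> C \<Phi> h (l k) x))"
      using l by (intro le_Limsup always_eventually allI) (auto intro!: cINF_lower bdd)
    ultimately show "?I \<le> prob_fun M \<xi> K \<Phi> x" by (metis ereal_less_eq(3) order_trans)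
    show "prob_fun M \<xi> K \<Phi> x \<le> ?I" using ge by (intro cINF_greatest) auto
  qed
  have D_open: "open (slater_set C \<Phi> h)"
  proof -
    have "slater_set C \<Phi> h = (\<Union>z. {x. s (x, z) < h x})" unfolding D by blast
    moreover have "continuous_on UNIV (\<lambda>x. s (x, z))" for z
      using s(3) by (rule continuous_on_compose2) (auto intro!: continuous_intros)
    then have "open {x. s (x, z) < h x}" for z
      using contH by (rule open_Collect_less)
    ultimately show ?thesis by auto
  qed
  have lim: "(\<lambda>k. prob_fun_reg M \<xi> C \<Phi> h (l k) (X k)) \<longlonglongrightarrow> prob_fun M \<xi> K \<Phi> x"
    if l: "\<And>k. 0 < l k" "l \<longlonglongrightarrow> 0" and X: "X \<longlonglongrightarrow> x" and x: "x \<in> slater_set C \<Phi> h" for l X x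
  proof -
    obtain z0 where z0: "s (x, z0) < h x" using x D by auto
    \<comment> \<open>The envelopes lie below \<open>s\<close>, so the upper bound that continuity
      gives for \<open>s\<close> passes to them for every parameter.\<close>
    have upp: "\<forall>\<^sub>F k in sequentially. real_env (l k) s (X k, z) < c" if "s (x, z) < c" for z c
      using upper[OF s(3) X that]
      by eventually_elim (rule le_less_trans[OF real_env_le[OF s(2,3) l(1)]])
    show ?thesis
      unfolding P R[OF l(1)]
      using z0 hX[OF X] real_env_liminf[OF s(2,3) l weakly_tendsto_Pair[OF weakly_tendsto_of_tendsto[OF X]]] upp
      by (rule tendsto_level_prob[OF assms(12) s(3) env(2)[OF l(1)] s(2)])
  qed
  have weak_usc: "seq_weakly_usc (level_prob M \<xi> g h)"
    if "seq_weakly_continuous h" "convex_on UNIV g" "continuous_on UNIV g" for g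
    using usc that unfolding seq_weakly_usc_def seq_weakly_continuous_def by blast
  have norm_usc: "seq_usc (level_prob M \<xi> g h)" if "convex_on UNIV g" "continuous_on UNIV g" for g
    using usc that hX weakly_tendsto_of_tendsto unfolding seq_usc_def by blast
  show ?thesis
  \<comment> \<open>Goals 1 and 2 are monotonicity and the infimum, 3 and 4 the upper limits, 5 and
    6 openness and the limit on the Slater set, 7 to 10 weak and norm upper semicontinuity, 11 and
    12 continuity.\<close>
  proof (intro conjI allI impI, goal_cases)
    case (1 l1 l2 x)
    then show ?case using mono by blast
  next
    case (2 x)
    show ?case by (rule INF)
  next
    case (3 l X x)
    then show ?case using usc_reg[of l X x] weakly_tendsto_of_tendsto hX by blast
  next
    case (4 l X x)
    then show ?case using usc_reg[of l X x] unfolding seq_weakly_continuous_def by blast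
  next
    case 5
    show ?case by (rule D_open)
  next
    case (6 l X x)
    then show ?case using lim[of l X x] by blast
  next
    case 7
    then show ?case unfolding P by (rule weak_usc[OF _ s(2,3)])
  next
    case (8 l)
    then show ?case using weak_usc[OF _ env] R by simp
  next
    case 9
    show ?case unfolding P by (rule norm_usc[OF s(2,3)])
  next
    case (10 l)
    then show ?case using norm_usc[OF env] R by simp
  next
    case 11
    show ?case unfolding P by (rule cont[OF s(2,3) order_refl])
  next
    case (12 l)
    then show ?case using cont[OF env real_env_le[OF s(2,3)]] R by simp
  qed
qed

end
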